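(* There is a sequence of real numbers $(\varepsilon_n)_{n\ge 2}$ with $\varepsilon_n\to 0$ as $n\to\infty$ such that for every $n\ge 2$ and every graph $G$ with $n$ vertices, $$\frac{|A(G)|}{\binom{n}{2}} \le (1+\varepsilon_n)\,\frac{13}{24},$$ where $A(G)$ is the set of (indices of) non-zero elements in the joint degree vector of $G$.
   Context: Graphs are finite and simple. For an $n$-vertex graph $G=(V,E)$ and $1\le i\le n-1$, let $V_i$ be the set of vertices of degree $i$. The joint degree vector (JDV) of $G$ has components $j_{ik}(G)=|\{xy\in E(G): x\in V_i,\ y\in V_k\}|$ for $1\le i\le k\le n-1$ (the number of edges joining a vertex of degree $i$ to a vertex of degree $k$). Set $A(G)=\{(i,k): 1\le i\le k\le n-1,\ j_{ik}(G)\neq 0\}$. *)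

theory Defs
  imports Complex_Main "HOL-Library.Ramsey"
begin

text \<open>
  An edge \<open>xy\<close> is the two-element set \<open>{x, y}\<close>, and \<open>nsets V 2\<close> is the set of all
  two-element subsets of \<open>V\<close>; hence there are no loops or multiple edges.
\<close>

definition simple_graph :: "'a set \<Rightarrow> 'a set set \<Rightarrow> bool" where
  "simple_graph V E \<longleftrightarrow> finite V \<and> E \<subseteq> nsets V 2"

definition vertex_degree :: "'a set set \<Rightarrow> 'a \<Rightarrow> nat" where
  "vertex_degree E v = card {e \<in> E. v \<in> e}"

definition degree_class :: "'a set \<Rightarrow> 'a set set \<Rightarrow> nat \<Rightarrow> 'a set" where
  "degree_class V E i = {v \<in> V. vertex_degree E v = i}"

definition joint_degree :: "'a set \<Rightarrow> 'a set set \<Rightarrow> nat \<Rightarrow> nat \<Rightarrow> nat" where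
  "joint_degree V E i k =
     card {{x, y} | x y. x \<in> degree_class V E i \<and> y \<in> degree_class V E k \<and> {x, y} \<in> E}"

definition joint_degree_support :: "'a set \<Rightarrow> 'a set set \<Rightarrow> (nat \<times> nat) set" where
  "joint_degree_support V E =
     {(i, k). 1 \<le> i \<and> i \<le> k \<and> k \<le> card V - 1 \<and> joint_degree V E i k \<noteq> 0}"

end

theory Submission
  imports Defs
begin

text \<open>
  Let \<open>D\<close> be the set of positive degrees that occur, \<open>d\<close> its size, and \<open>v\<^sub>i \<ge> 1\<close> the number of
  vertices of degree \<open>i \<in> D\<close>. Counting ordered pairs of degrees instead of unordered ones costs only
  the diagonal, so twice the size of the support is at most \<open>d\<close> plus the sum over \<open>i \<in> D\<close> of the
  number of degrees seen from the class of degree \<open>i\<close>. That number is at most \<open>d\<close>, and it is at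
  most \<open>i * v\<^sub>i\<close> because the class emits only \<open>i * v\<^sub>i\<close> edge ends.

  A single vertex of degree \<open>i\<close> sees at most \<open>min d i\<close> degrees, and each further vertex is charged
  \<open>d/2\<close> (\<open>min_mult_le_min_plus_half\<close>). There are at most \<open>n - d\<close> further vertices, which gives
  \<open>(\<Sum>i\<in>D. min d i) + d * (n - d) / 2\<close>. The first sum is largest when \<open>D\<close> consists of the top \<open>d\<close>
  values below \<open>n\<close> (\<open>sum_min_card_le\<close>). What remains is a quadratic in \<open>d\<close>; asymptotically it is
  \<open>d\<^sup>2 - (2*d - n)\<^sup>2 / 2 + d * (n - d) / 2\<close> for \<open>2 * d \<ge> n\<close>, with the maximum
  \<open>13/24 * n\<^sup>2\<close> at \<open>d = 5/6 * n\<close> (\<open>degree_budget_le\<close>). The support thus has at most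
  \<open>13/48 * n\<^sup>2 + n/2\<close> elements, and the linear term is absorbed in an error of order \<open>1/n\<close>.
\<close>

section \<open>Numerical estimates\<close>

text \<open>
  The charge \<open>d/2\<close> per additional copy is enough in both regimes: if \<open>i < d/2\<close>, a copy adds only
  \<open>i\<close>; if \<open>i \<ge> d/2\<close>, the first copy already reaches half of the cap, and one more charge pays for
  all the rest.
\<close>

lemma min_mult_le_min_plus_half:
  fixes d i v :: nat
  assumes "v \<ge> 1"
  shows "2 * min d (i * v) \<le> 2 * min d i + d * (v - 1)"
proof -
  obtain w where v: "v = Suc w"
    using assms by (cases v) auto
  show ?thesis
  proof (cases "2 * i < d")
    case True
    have "2 * min d (i * v) \<le> 2 * (i * v)" by simp
    also have "\<dots> = 2 * i + (2 * i) * w" by (simp add: v)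
    also have "\<dots> \<le> 2 * i + d * w"
      using True by (intro add_left_mono mult_right_mono) auto
    also have "\<dots> = 2 * min d i + d * (v - 1)"
      using True by (simp add: v)
    finally show ?thesis .
  next
    case False
    then have "2 * min d (i * v) \<le> 2 * min d i + d * w"
      by (cases w) (auto simp: v)
    then show ?thesis by (simp add: v)
  qed
qed

text \<open>
  Layer-cake counting: \<open>min (card D) i\<close> is the number of levels \<open>t\<close> in \<open>{1..card D}\<close> with \<open>t \<le> i\<close>,
  and level \<open>t\<close> is reached only by the elements of \<open>D\<close> in \<open>{t..<n}\<close>.
\<close>

lemma sum_min_card_le:
  fixes D :: "nat set"
  assumes "D \<subseteq> {1..<n}"
  shows "(\<Sum>i\<in>D. min (card D) i) \<le> (\<Sum>t=1..card D. min (card D) (n - t))"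
proof -
  have fin: "finite D"
    using assms finite_subset by blast
  have "(\<Sum>i\<in>D. min (card D) i) = (\<Sum>i\<in>D. card {t \<in> {1..card D}. t \<le> i})"
  proof (rule sum.cong)
    fix i
    have "{t \<in> {1..card D}. t \<le> i} = {1..min (card D) i}" by auto
    then show "min (card D) i = card {t \<in> {1..card D}. t \<le> i}" by simp
  qed simp
  also have "\<dots> = (\<Sum>t=1..card D. card {i \<in> D. t \<le> i})"
    using fin by (intro sum_multicount_gen) auto
  also have "\<dots> \<le> (\<Sum>t=1..card D. min (card D) (n - t))"
  proof (rule sum_mono)
    fix t
    have "card {i \<in> D. t \<le> i} \<le> card D"
      using fin by (intro card_mono) auto
    moreover have "card {i \<in> D. t \<le> i} \<le> card {t..<n}"
      using assms by (intro card_mono) auto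
    ultimately show "card {i \<in> D. t \<le> i} \<le> min (card D) (n - t)" by simp
  qed
  finally show ?thesis .
qed

lemma double_sum_consecutive:
  fixes c m :: nat
  shows "2 * (\<Sum>s=c..<c+m. s) + m = 2 * m * c + m * m"
  by (induction m) (auto simp: algebra_simps)

text \<open>
  For \<open>n < 2 * d\<close> write \<open>d = c + m\<close> and \<open>n = 2 * c + m\<close>. The gap between the two sides is then
  \<open>(4 * c - m)\<^sup>2\<close> plus a linear term, which is where the constant 13/24 comes from.
\<close>

lemma degree_budget_le:
  fixes d n :: nat
  assumes "d \<le> n"
  shows "24 * (\<Sum>t=1..d. min d (n - t)) + 12 * (d * (n - d)) \<le> 13 * n\<^sup>2"
proof (cases "2 * d \<le> n")
  case True
  then obtain r where n: "n = 2 * d + r"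
    using le_Suc_ex by blast
  have "(\<Sum>t=1..d. min d (n - t)) \<le> (\<Sum>t=1..d. d)"
    by (intro sum_mono) simp
  then have "(\<Sum>t=1..d. min d (n - t)) \<le> d * d" by simp
  moreover have "24 * (d * d) + 12 * (d * (n - d)) \<le> 13 * n\<^sup>2"
    by (simp add: n power2_eq_square algebra_simps)
  ultimately show ?thesis by linarith
next
  case False
  define c where "c = n - d"
  define m where "m = 2 * d - n"
  have d: "d = c + m" and n: "n = 2 * c + m"
    using False assms by (auto simp: c_def m_def)
  have "(\<Sum>t=1..d. min d (n - t)) = (\<Sum>t=1..c. min d (n - t)) + (\<Sum>t=c+1..c+m. min d (n - t))"
    unfolding d by (rule sum.ub_add_nat) simp
  also have "(\<Sum>t=1..c. min d (n - t)) = (\<Sum>t=1..c. d)"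
    by (intro sum.cong) (auto simp: d n)
  also have "(\<Sum>t=c+1..c+m. min d (n - t)) = (\<Sum>s=c..<c+m. s)"
    by (rule sum.reindex_bij_witness[of _ "\<lambda>s. n - s" "\<lambda>t. n - t"]) (auto simp: d n)
  finally have eq: "(\<Sum>t=1..d. min d (n - t)) = c * d + (\<Sum>s=c..<c+m. s)" by simp
  have "0 \<le> (4 * int c - int m)\<^sup>2" by simp
  then have "int (36 * (c * c) + 60 * (m * c) + 12 * (m * m)) \<le> int (13 * n\<^sup>2)"
    by (simp add: n power2_eq_square algebra_simps)
  then have "36 * (c * c) + 60 * (m * c) + 12 * (m * m) \<le> 13 * n\<^sup>2"
    by linarith
  moreover have "24 * (c * d) + 12 * (d * (n - d)) = 36 * (c * c) + 36 * (m * c)"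
    by (simp add: d n algebra_simps)
  ultimately show ?thesis
    using eq double_sum_consecutive[of c m] by (simp add: algebra_simps)
qed

section \<open>Degree classes and the pairs of degrees joined by an edge\<close>

definition occurring_degrees :: "'a set \<Rightarrow> 'a set set \<Rightarrow> nat set" where
  "occurring_degrees V E = {i \<in> {1..<card V}. degree_class V E i \<noteq> {}}"

definition joined_degrees :: "'a set \<Rightarrow> 'a set set \<Rightarrow> nat \<Rightarrow> nat set" where
  "joined_degrees V E i =
     {k \<in> occurring_degrees V E. \<exists>x\<in>degree_class V E i. \<exists>y\<in>degree_class V E k. {x, y} \<in> E}"

lemma occurring_degrees_subset: "occurring_degrees V E \<subseteq> {1..<card V}"
  by (auto simp: occurring_degrees_def)

lemma finite_occurring_degrees [simp]: "finite (occurring_degrees V E)"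
  by (simp add: occurring_degrees_def)

lemma card_neighbours_eq_vertex_degree:
  assumes "E \<subseteq> nsets V 2"
  shows "card {y. {x, y} \<in> E} = vertex_degree E x"
  unfolding vertex_degree_def
proof (rule bij_betw_same_card)
  have two: "card e = 2" if "e \<in> E" for e
    using assms that by (auto simp: nsets_def)
  show "bij_betw (\<lambda>y. {x, y}) {y. {x, y} \<in> E} {e \<in> E. x \<in> e}"
  proof (rule bij_betw_imageI)
    show "inj_on (\<lambda>y. {x, y}) {y. {x, y} \<in> E}"
      by (auto simp: inj_on_def doubleton_eq_iff)
    show "(\<lambda>y. {x, y}) ` {y. {x, y} \<in> E} = {e \<in> E. x \<in> e}"
    proof (intro equalityI subsetI)
      fix e assume e: "e \<in> {e \<in> E. x \<in> e}"
      with two have "card e = 2" by simp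
      then obtain a b where "e = {a, b}"
        by (auto simp: card_2_iff)
      with e show "e \<in> (\<lambda>y. {x, y}) ` {y. {x, y} \<in> E}"
        by (auto simp: insert_commute)
    qed auto
  qed
qed

lemma card_joined_degrees_le:
  assumes "simple_graph V E"
  shows "card (joined_degrees V E i) \<le> i * card (degree_class V E i)"
proof -
  have finV: "finite V" and E: "E \<subseteq> nsets V 2"
    using assms by (auto simp: simple_graph_def)
  have fin: "finite (degree_class V E i)"
    using finV by (simp add: degree_class_def)
  have nb: "{y. {x, y} \<in> E} \<subseteq> V" for x
    using E by (auto simp: nsets_def)
  let ?N = "\<Union>x\<in>degree_class V E i. {y. {x, y} \<in> E}"
  have finN: "finite ?N"
    by (rule finite_subset[OF _ finV]) (use nb in blast)
  have "joined_degrees V E i \<subseteq> vertex_degree E ` ?N"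
    by (auto simp: joined_degrees_def degree_class_def)
  then have "card (joined_degrees V E i) \<le> card ?N"
    using finN surj_card_le by blast
  also have "\<dots> \<le> (\<Sum>x\<in>degree_class V E i. card {y. {x, y} \<in> E})"
    by (rule card_UN_le[OF fin])
  also have "\<dots> = (\<Sum>x\<in>degree_class V E i. i)"
    by (intro sum.cong) (auto simp: card_neighbours_eq_vertex_degree[OF E] degree_class_def)
  finally show ?thesis by (simp add: mult.commute)
qed

lemma sum_card_degree_class_le:
  assumes "finite V"
  shows "(\<Sum>i\<in>occurring_degrees V E. card (degree_class V E i)) \<le> card V"
proof -
  have "(\<Sum>i\<in>occurring_degrees V E. card (degree_class V E i))
      = card (\<Union>i\<in>occurring_degrees V E. degree_class V E i)"
    using assms by (intro card_UN_disjoint[symmetric]) (auto simp: degree_class_def)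
  also have "\<dots> \<le> card V"
    using assms by (intro card_mono) (auto simp: degree_class_def)
  finally show ?thesis .
qed

text \<open>
  The support and its mirror image both lie in the symmetric relation of joined degrees, and they
  overlap only in the diagonal.
\<close>

lemma double_card_joint_degree_support_le:
  "2 * card (joint_degree_support V E)
     \<le> (\<Sum>i\<in>occurring_degrees V E. card (joined_degrees V E i)) + card (occurring_degrees V E)"
proof -
  let ?A = "joint_degree_support V E"
  let ?D = "occurring_degrees V E"
  let ?R = "Sigma ?D (joined_degrees V E)"
  have edge: "\<exists>x\<in>degree_class V E i. \<exists>y\<in>degree_class V E k. {x, y} \<in> E"
    if "(i, k) \<in> ?A" for i k
  proof -
    have "joint_degree V E i k \<noteq> 0"
      using that by (simp add: joint_degree_support_def)
    then have "{{x, y} | x y. x \<in> degree_class V E i \<and> y \<in> degree_class V E k \<and> {x, y} \<in> E} \<noteq> {}"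
      unfolding joint_degree_def by (metis card.empty)
    then show ?thesis by blast
  qed
  have occ: "i \<in> ?D \<and> k \<in> ?D" if "(i, k) \<in> ?A" for i k
    using edge[OF that] that by (auto simp: occurring_degrees_def joint_degree_support_def)
  have joined: "i \<in> ?D \<and> k \<in> joined_degrees V E i" if "(i, k) \<in> ?A" for i k
    using edge[OF that] occ[OF that] by (simp add: joined_degrees_def)
  have joined_sym: "k \<in> ?D \<and> i \<in> joined_degrees V E k" if ik: "(i, k) \<in> ?A" for i k
  proof -
    obtain x y where "x \<in> degree_class V E i" "y \<in> degree_class V E k" "{y, x} \<in> E"
      using edge[OF ik] by (auto simp: insert_commute)
    then show ?thesis
      using occ[OF ik] by (auto simp: joined_degrees_def)
  qed
  have sub: "?A \<subseteq> ?R" and sub': "?A\<inverse> \<subseteq> ?R"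
    using joined joined_sym by auto
  have finR: "finite ?R"
    by (intro finite_SigmaI) (auto simp: joined_degrees_def)
  have finA: "finite ?A"
    using sub finR finite_subset by blast
  have "?A \<inter> ?A\<inverse> \<subseteq> (\<lambda>i. (i, i)) ` ?D"
  proof
    fix p assume p: "p \<in> ?A \<inter> ?A\<inverse>"
    then obtain i where "p = (i, i)"
      by (auto simp: joint_degree_support_def)
    with p occ show "p \<in> (\<lambda>i. (i, i)) ` ?D" by blast
  qed
  then have diag: "card (?A \<inter> ?A\<inverse>) \<le> card ?D"
    by (rule surj_card_le[rotated]) simp
  have "2 * card ?A = card ?A + card (?A\<inverse>)"
    by simp
  also have "\<dots> = card (?A \<union> ?A\<inverse>) + card (?A \<inter> ?A\<inverse>)"
    using finA by (intro card_Un_Int) auto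
  also have "\<dots> \<le> card ?R + card ?D"
    using sub sub' finR diag by (intro add_mono card_mono) auto
  also have "card ?R = (\<Sum>i\<in>?D. card (joined_degrees V E i))"
    by (intro card_SigmaI) (auto simp: joined_degrees_def)
  finally show ?thesis .
qed

section \<open>The bound on the support\<close>

lemma card_joint_degree_support_le:
  assumes "simple_graph V E"
  shows "48 * card (joint_degree_support V E) \<le> 13 * (card V)\<^sup>2 + 24 * card V"
proof -
  let ?D = "occurring_degrees V E"
  let ?v = "\<lambda>i. card (degree_class V E i)"
  define n where "n = card V"
  define d where "d = card ?D"
  have finV: "finite V"
    using assms by (simp add: simple_graph_def)
  have D: "?D \<subseteq> {1..<n}"
    unfolding n_def by (rule occurring_degrees_subset)
  have "d \<le> card {1..<n}"
    unfolding d_def using D by (intro card_mono) auto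
  then have dn: "d \<le> n" by simp
  have v: "?v i \<ge> 1" if "i \<in> ?D" for i
    using that finV by (auto simp: occurring_degrees_def degree_class_def Suc_le_eq card_gt_0_iff)
  have "(\<Sum>i\<in>?D. ?v i - 1) + d = (\<Sum>i\<in>?D. (?v i - 1) + 1)"
    unfolding sum.distrib by (simp add: d_def)
  also have "\<dots> = (\<Sum>i\<in>?D. ?v i)"
    by (intro sum.cong refl le_add_diff_inverse2 v)
  finally have "(\<Sum>i\<in>?D. ?v i - 1) + d = (\<Sum>i\<in>?D. ?v i)" .
  then have extra: "(\<Sum>i\<in>?D. ?v i - 1) \<le> n - d"
    using sum_card_degree_class_le[OF finV, of E] unfolding n_def by linarith
  have "2 * (\<Sum>i\<in>?D. card (joined_degrees V E i)) = (\<Sum>i\<in>?D. 2 * card (joined_degrees V E i))"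
    by (simp add: sum_distrib_left)
  also have "\<dots> \<le> (\<Sum>i\<in>?D. 2 * min d i + d * (?v i - 1))"
  proof (rule sum_mono)
    fix i assume i: "i \<in> ?D"
    have "card (joined_degrees V E i) \<le> d"
      unfolding d_def by (intro card_mono) (auto simp: joined_degrees_def)
    then have "2 * card (joined_degrees V E i) \<le> 2 * min d (i * ?v i)"
      using card_joined_degrees_le[OF assms, of i] by simp
    also have "\<dots> \<le> 2 * min d i + d * (?v i - 1)"
      by (rule min_mult_le_min_plus_half[OF v[OF i]])
    finally show "2 * card (joined_degrees V E i) \<le> 2 * min d i + d * (?v i - 1)" .
  qed
  also have "\<dots> = 2 * (\<Sum>i\<in>?D. min d i) + d * (\<Sum>i\<in>?D. ?v i - 1)"
    by (simp add: sum.distrib sum_distrib_left)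
  also have "\<dots> \<le> 2 * (\<Sum>t=1..d. min d (n - t)) + d * (n - d)"
    using sum_min_card_le[OF D] extra unfolding d_def
    by (intro add_mono mult_left_mono) auto
  finally have "24 * (\<Sum>i\<in>?D. card (joined_degrees V E i)) \<le> 13 * n\<^sup>2"
    using degree_budget_le[OF dn] by linarith
  then show ?thesis
    using double_card_joint_degree_support_le[of V E] dn unfolding d_def n_def by linarith
qed

text \<open>
  Dividing \<open>13 * n\<^sup>2 + 24 * n\<close> by \<open>48 * (n choose 2) = 24 * n * (n - 1)\<close> gives exactly \<open>13/24\<close> times
  \<open>1 + (37/13) / (n - 1)\<close>.
\<close>

theorem theorem2:
  shows "\<exists>\<epsilon> :: nat \<Rightarrow> real. \<epsilon> \<longlonglongrightarrow> 0 \<and>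
    (\<forall>n\<ge>2. \<forall>(V :: 'a set) (E :: 'a set set).
       simple_graph V E \<and> card V = n \<longrightarrow>
       real (card (joint_degree_support V E)) / real (n choose 2) \<le> (1 + \<epsilon> n) * (13 / 24))"
proof (intro exI conjI allI impI)
  let ?\<epsilon> = "\<lambda>n::nat. 37 / 13 / (real n - 1)"
  have "(\<lambda>n. 37 / 13 / real n) \<longlonglongrightarrow> 0"
    by (rule lim_const_over_n)
  then have "(\<lambda>n. ?\<epsilon> (Suc n)) \<longlonglongrightarrow> 0" by simp
  then show "?\<epsilon> \<longlonglongrightarrow> 0"
    by (rule LIMSEQ_imp_Suc)
  fix n :: nat and V :: "'a set" and E :: "'a set set"
  assume n: "2 \<le> n" and G: "simple_graph V E \<and> card V = n"
  define a where "a = card (joint_degree_support V E)"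
  have "48 * a \<le> 13 * n\<^sup>2 + 24 * n"
    using card_joint_degree_support_le[of V E] G by (simp add: a_def)
  then have "real (48 * a) \<le> real (13 * n\<^sup>2 + 24 * n)"
    by (rule of_nat_mono)
  then have a: "48 * real a \<le> 13 * (real n)\<^sup>2 + 24 * real n" by simp
  have ch: "real (n choose 2) = real n * (real n - 1) / 2"
    using n by (simp add: choose_two real_of_nat_div of_nat_diff)
  have pos: "0 < real n * (real n - 1) / 2"
    using n by simp
  have eq: "(1 + ?\<epsilon> n) * (13 / 24) * (real n * (real n - 1) / 2) = (13 * (real n)\<^sup>2 + 24 * real n) / 48"
    using n by (simp add: field_simps power2_eq_square)
  have "real a \<le> (1 + ?\<epsilon> n) * (13 / 24) * (real n * (real n - 1) / 2)"
    unfolding eq using a by simp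
  then show "real (card (joint_degree_support V E)) / real (n choose 2) \<le> (1 + ?\<epsilon> n) * (13 / 24)"
    by (simp only: ch a_def[symmetric] pos_divide_le_eq[OF pos])
qed

end
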